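(* If $\Pi=(\mathcal{P},\mathcal{L})$ is a projective plane of order $n\geq 5$, then $\Pi$ is magic over the group $G=(\mathbb{Z}/n\mathbb{Z})^3$.
   Context: A projective plane $\Pi=(\mathcal{P},\mathcal{L})$ consists of points $\mathcal{P}$ and lines $\mathcal{L}$ (subsets of $\mathcal{P}$) such that any two distinct points lie on a unique common line, any two distinct lines meet in a unique point, and there exist four points no three collinear. A finite projective plane has an order $n$: every line has $n+1$ points, every point is on $n+1$ lines, and $|\mathcal{P}|=|\mathcal{L}|=n^2+n+1$. For an Abelian group $G$, a function $v:\mathcal{P}\to G$ is magic if it is injective and $\sum_{x\in L}v(x)$ is the same for all $L\in\mathcal{L}$ (injectivity implies non-constant). $\Pi$ is magic over $G$ if such a $v$ exists. *)

theory Defs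
  imports "HOL-Algebra.Elementary_Groups" "HOL-Algebra.FiniteProduct"
begin

locale projective_plane =
  fixes P :: "'a set" and Ls :: "'a set set"
  assumes line_subset: "L \<in> Ls \<Longrightarrow> L \<subseteq> P"
    and unique_line:
      "\<lbrakk>x \<in> P; y \<in> P; x \<noteq> y\<rbrakk> \<Longrightarrow> \<exists>!L. L \<in> Ls \<and> x \<in> L \<and> y \<in> L"
    and unique_point:
      "\<lbrakk>L \<in> Ls; M \<in> Ls; L \<noteq> M\<rbrakk> \<Longrightarrow> \<exists>!x. x \<in> L \<and> x \<in> M"
    and quadrangle:
      "\<exists>Q \<subseteq> P. card Q = 4 \<and> (\<forall>T \<subseteq> Q. card T = 3 \<longrightarrow> \<not> (\<exists>L \<in> Ls. T \<subseteq> L))"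

text \<open>
  Only the number of points per line is assumed; the other counts are the lemmas
  \<open>card_lines_through\<close>, \<open>card_points\<close> and \<open>card_lines\<close> below.
\<close>

locale projective_plane_of_order = projective_plane P Ls
  for P :: "'a set" and Ls :: "'a set set" +
  fixes n :: nat
  assumes finite_points: "finite P"
    and card_line: "L \<in> Ls \<Longrightarrow> card L = n + 1"

text \<open>
  The group \<open>G\<close> is written multiplicatively, so \<open>\<Otimes>\<close> is its sum. A product over an infinite
  set is \<open>\<one>\<close> by convention, hence these two notions are meant for planes with finite lines.
\<close>

definition magic_function ::
    "('g, 'm) monoid_scheme \<Rightarrow> 'a set \<Rightarrow> 'a set set \<Rightarrow> ('a \<Rightarrow> 'g) \<Rightarrow> bool" where
  "magic_function G P Ls v \<longleftrightarrow>
     v \<in> P \<rightarrow> carrier G \<and> inj_on v P \<and>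
     (\<forall>L \<in> Ls. \<forall>M \<in> Ls. (\<Otimes>\<^bsub>G\<^esub>x\<in>L. v x) = (\<Otimes>\<^bsub>G\<^esub>x\<in>M. v x))"

definition magic_over :: "('g, 'm) monoid_scheme \<Rightarrow> 'a set \<Rightarrow> 'a set set \<Rightarrow> bool" where
  "magic_over G P Ls \<longleftrightarrow> (\<exists>v. magic_function G P Ls v)"

context projective_plane
begin

lemma same_line:
  "\<lbrakk>L \<in> Ls; M \<in> Ls; x \<noteq> y; x \<in> L; y \<in> L; x \<in> M; y \<in> M\<rbrakk> \<Longrightarrow> L = M"
  using unique_line[of x y] line_subset by blast

lemma line_avoiding:
  obtains L where "L \<in> Ls" "p \<notin> L"
proof -
  obtain Q where Q: "Q \<subseteq> P" "card Q = 4"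
      "\<And>T. \<lbrakk>T \<subseteq> Q; card T = 3\<rbrakk> \<Longrightarrow> \<not> (\<exists>L \<in> Ls. T \<subseteq> L)"
    using quadrangle by blast
  obtain a b c d where abcd: "Q = {a, b, c, d}" "distinct [a, b, c, d]"
    using Q(2) by (auto simp: card_Suc_eq numeral_eq_Suc)
  have nc: "\<not> (\<exists>L \<in> Ls. a \<in> L \<and> b \<in> L \<and> c \<in> L)"
    using Q(3)[of "{a, b, c}"] abcd by auto
  have P: "a \<in> P" "b \<in> P" "c \<in> P" using Q(1) abcd by auto
  have ne: "a \<noteq> b" "a \<noteq> c" "b \<noteq> c" using abcd by auto
  obtain L where L: "L \<in> Ls" "a \<in> L" "b \<in> L" using unique_line[of a b] P ne by auto
  obtain M where M: "M \<in> Ls" "a \<in> M" "c \<in> M" using unique_line[of a c] P ne by auto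
  obtain N where N: "N \<in> Ls" "b \<in> N" "c \<in> N" using unique_line[of b c] P ne by auto
  have "L \<noteq> M" "L \<noteq> N" using L M N nc by auto
  then have "p \<notin> L \<or> p \<notin> M \<or> p \<notin> N"
    using same_line[of L M p a] same_line[of L N p b] L M N ne(1) by metis
  then show thesis using that L M N by blast
qed

end

context projective_plane_of_order
begin

lemma finite_lines: "finite Ls"
  using finite_points line_subset by (intro finite_subset[of Ls "Pow P"]) auto

lemma finite_line: "L \<in> Ls \<Longrightarrow> finite L"
  using finite_points line_subset finite_subset by blast

lemma card_lines_through:
  assumes p: "p \<in> P"
  shows "card {L \<in> Ls. p \<in> L} = n + 1"
proof -
  obtain M where M: "M \<in> Ls" "p \<notin> M" using line_avoiding by blast
  define f where "f x = (THE L. L \<in> Ls \<and> p \<in> L \<and> x \<in> L)" for x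
  have f: "f x \<in> Ls \<and> p \<in> f x \<and> x \<in> f x" if "x \<in> M" for x
  proof -
    have "p \<noteq> x" "x \<in> P" using that M line_subset by auto
    then show ?thesis unfolding f_def using theI'[OF unique_line[OF p]] by blast
  qed
  have "inj_on f M"
  proof (rule inj_onI)
    fix x y assume xy: "x \<in> M" "y \<in> M" "f x = f y"
    show "x = y"
      using same_line[of M "f x" x y] f[OF xy(1)] f[OF xy(2)] xy M by metis
  qed
  moreover have "f ` M = {L \<in> Ls. p \<in> L}"
  proof (intro equalityI subsetI)
    fix L assume L: "L \<in> {L \<in> Ls. p \<in> L}"
    then obtain x where x: "x \<in> L" "x \<in> M" using unique_point[of L M] M by blast
    then have "L = f x" using same_line[of L "f x" p x] f[OF x(2)] L M by auto
    then show "L \<in> f ` M" using x by blast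
  qed (use f in auto)
  ultimately show ?thesis using card_image[of f M] card_line[OF M(1)] by simp
qed

lemma card_points: "card P = n\<^sup>2 + n + 1"
proof -
  obtain Q where "Q \<subseteq> P" "card Q = 4" using quadrangle by blast
  then obtain p where p: "p \<in> P" by (metis card.empty ex_in_conv subset_iff zero_neq_numeral)
  let ?S = "{L \<in> Ls. p \<in> L}"
  have "P - {p} = (\<Union>L\<in>?S. L - {p})"
  proof (intro equalityI subsetI)
    fix x assume "x \<in> P - {p}"
    then obtain L where "L \<in> Ls" "p \<in> L" "x \<in> L" using unique_line[OF p, of x] by blast
    then show "x \<in> (\<Union>L\<in>?S. L - {p})" using \<open>x \<in> P - {p}\<close> by blast
  qed (use line_subset in blast)
  moreover have "(L - {p}) \<inter> (M - {p}) = {}" if "L \<in> ?S" "M \<in> ?S" "L \<noteq> M" for L M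
  proof (rule ccontr)
    assume "(L - {p}) \<inter> (M - {p}) \<noteq> {}"
    then obtain y where "y \<noteq> p" "y \<in> L" "y \<in> M" by blast
    then show False using that same_line[of L M p y] by blast
  qed
  moreover have "finite ?S" using finite_lines by simp
  moreover have "\<forall>L\<in>?S. finite (L - {p})" using finite_line by simp
  ultimately have "card (P - {p}) = (\<Sum>L\<in>?S. card (L - {p}))"
    by (simp only:) (rule card_UN_disjoint, simp_all)
  also have "\<dots> = (\<Sum>L\<in>?S. n)" using card_line finite_line by (intro sum.cong) auto
  also have "\<dots> = (n + 1) * n" using card_lines_through[OF p] by simp
  finally have "card (P - {p}) = (n + 1) * n" .
  then show ?thesis
    using card_Suc_Diff1[OF finite_points p] by (simp add: power2_eq_square)
qed

lemma card_lines: "card Ls = n\<^sup>2 + n + 1"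
proof -
  have "(\<Sum>L\<in>Ls. card {x \<in> P. x \<in> L}) = (n + 1) * card P"
    using finite_lines finite_points card_lines_through
    by (intro sum_multicount) auto
  moreover have "card {x \<in> P. x \<in> L} = n + 1" if "L \<in> Ls" for L
    using card_line[OF that] line_subset[OF that] by (metis Collect_conj_eq Collect_mem_eq inf.absorb2)
  ultimately have "card Ls * (n + 1) = (n + 1) * card P" by simp
  then have "card Ls = card P" by (metis Suc_eq_plus1 mult.commute mult_cancel1 nat.distinct(1))
  then show ?thesis using card_points by simp
qed

end

end

theory Submission
  imports Defs
begin

text \<open>
  Modulo \<open>n\<close>, the indicator function of a line has sum 1 on every line, itself included. So for any
  integer weighting of the lines, giving each point the total weight of the lines through it
  yields constant line sums modulo \<open>n\<close>, and it remains to find three weightings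
  that together separate the points.

  Fix a line \<open>l\<close> through \<open>p \<noteq> q\<close>. Weight the lines through \<open>p\<close> by \<open>0, 0, 1, 2, \<dots>, n - 1\<close>, with 1 on
  \<open>l\<close> and 0 on two lines \<open>A\<close>, \<open>A'\<close>; do the same at \<open>q\<close> with \<open>C\<close>, \<open>C'\<close>. These two coordinates tell
  \<open>p\<close>, \<open>q\<close>, the rest of \<open>l\<close> and the points off \<open>l\<close> apart, and off \<open>l\<close> they determine the point
  up to exchanging \<open>A\<close> with \<open>A'\<close> and \<open>C\<close> with \<open>C'\<close>. The third weighting resolves these
  ambiguities and separates the points of \<open>l\<close> other than \<open>p\<close> and \<open>q\<close>. It lives on the lines through
  \<open>r = A \<inter> C\<close>, with weights 2 on \<open>A\<close> and 1 on \<open>C\<close> that are avoided by all other lines through \<open>r\<close>.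
  This leaves only \<open>n - 2\<close> values for \<open>n - 1\<close> lines, so 0 is used twice, on \<open>Y\<close> and \<open>Z\<close>; weight 1 on
  one further line \<open>K\<close>, joining \<open>A' \<inter> C'\<close> to \<open>l \<inter> Y\<close>, repairs the collision.
\<close>

section \<open>Sums in the cube of the integers modulo \<open>n\<close>\<close>

lemma comm_group_DirProd:
  assumes "comm_group G" "comm_group H"
  shows "comm_group (G \<times>\<times> H)"
proof -
  interpret G: comm_group G by fact
  interpret H: comm_group H by fact
  have "group (G \<times>\<times> H)" by (rule DirProd_group) unfold_locales
  then show ?thesis
    by (rule group.group_comm_groupI) (auto simp: G.m_comm H.m_comm)
qed

text \<open>Turns the condition on line sums in the group into three independent statements about
  integer sums. Positivity of \<open>n\<close> puts the residues into the carrier.\<close>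

lemma finprod_integer_mod_group_cube:
  fixes f g h :: "'a \<Rightarrow> int"
  assumes "finite S" and n: "n > 0"
  shows "(\<Otimes>\<^bsub>integer_mod_group n \<times>\<times> integer_mod_group n \<times>\<times> integer_mod_group n\<^esub>x\<in>S.
            (f x mod int n, g x mod int n, h x mod int n))
         = (sum f S mod int n, sum g S mod int n, sum h S mod int n)"
  using assms(1)
proof (induction S rule: finite_induct)
  let ?G = "integer_mod_group n \<times>\<times> integer_mod_group n \<times>\<times> integer_mod_group n"
  interpret comm_group ?G
    using abelian_integer_mod_group[of n] by (simp add: comm_group_DirProd)
  case empty
  show ?case by simp
next
  let ?G = "integer_mod_group n \<times>\<times> integer_mod_group n \<times>\<times> integer_mod_group n"
  interpret comm_group ?G
    using abelian_integer_mod_group[of n] by (simp add: comm_group_DirProd)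
  case (insert x S)
  have "(\<lambda>x. (f x mod int n, g x mod int n, h x mod int n)) \<in> T \<rightarrow> carrier ?G" for T
    using n by (auto simp: carrier_integer_mod_group)
  from finprod_insert[OF insert.hyps this] this[of "{x}"] insert.IH show ?case
    using insert.hyps by (simp add: Pi_iff mod_simps)
qed

section \<open>Residues of half of \<open>m * (m - 1)\<close>\<close>

lemma double_sum_atLeastLessThan_int:
  fixes k m :: int
  assumes "k \<le> m"
  shows "2 * \<Sum>{k..<m} = m * (m - 1) - k * (k - 1)"
  using assms
proof (induction m rule: int_ge_induct)
  case (step i)
  then have "{k..<i + 1} = insert i {k..<i}" by auto
  then show ?case using step by (simp add: algebra_simps)
qed simp

text \<open>Twice \<open>s\<close> vanishes modulo \<open>m\<close>, but twice \<open>k\<close> does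
  not. This is applied to \<open>s\<close> equal to half of \<open>n * (n - 1)\<close>, the value at
  the centre of a weighted pencil; doubling avoids a case split on the parity of
  \<open>n\<close>.\<close>

lemma half_multiple_mod_neq:
  fixes s k m :: int
  assumes "2 * s = m * j" and "k \<noteq> 0" and "2 * \<bar>k\<bar> < m"
  shows "s mod m \<noteq> k mod m"
proof
  assume "s mod m = k mod m"
  then have "m dvd s - k" by (simp add: mod_eq_dvd_iff)
  then have "m dvd 2 * s - 2 * k" by (metis dvd_mult right_diff_distrib)
  then have "m dvd 2 * k" using assms(1) by (metis dvd_diff_right_iff dvd_triv_left)
  then show False using assms(2,3) zdvd_not_zless[of "2 * \<bar>k\<bar>" m]
    by (metis abs_mult abs_numeral dvd_abs_iff mult_pos_pos zero_less_abs_iff zero_less_numeral)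
qed

section \<open>Joins and meets\<close>

context projective_plane
begin

lemma meet_unique:
  "\<lbrakk>L \<in> Ls; M \<in> Ls; L \<noteq> M; x \<in> L; x \<in> M; y \<in> L; y \<in> M\<rbrakk> \<Longrightarrow> x = y"
  using same_line by blast

lemma join_exists:
  assumes "x \<in> P" "y \<in> P" "x \<noteq> y"
  obtains L where "L \<in> Ls" "x \<in> L" "y \<in> L"
  using unique_line[OF assms] by blast

lemma meet_exists:
  assumes "L \<in> Ls" "M \<in> Ls" "L \<noteq> M"
  obtains x where "x \<in> P" "x \<in> L" "x \<in> M"
  using unique_point[OF assms] line_subset assms by blast

end

section \<open>Line weights and the three coordinates built from them\<close>

context projective_plane_of_order
begin

definition pencil :: "'a \<Rightarrow> 'a set set" where
  "pencil x = {L \<in> Ls. x \<in> L}"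

text \<open>The integer combination of the indicator functions of lines with coefficients
  \<open>w\<close>. It is left unreduced, so that values can be computed in the integers before
  passing to residues.\<close>

definition point_weight :: "('a set \<Rightarrow> int) \<Rightarrow> 'a \<Rightarrow> int" where
  "point_weight w x = sum w (pencil x)"

lemma finite_pencil [simp]: "finite (pencil x)"
  using finite_lines by (simp add: pencil_def)

lemma card_pencil: "x \<in> P \<Longrightarrow> card (pencil x) = n + 1"
  using card_lines_through by (simp add: pencil_def)

lemma in_pencil [simp]: "L \<in> pencil x \<longleftrightarrow> L \<in> Ls \<and> x \<in> L"
  by (simp add: pencil_def)

text \<open>Double counting: every line other than \<open>M\<close> meets \<open>M\<close> in one
  point and contributes its weight once, while \<open>M\<close> itself is counted at each of its
  \<open>n + 1\<close> points. The excess \<open>n * w M\<close> disappears modulo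
  \<open>n\<close>.\<close>

lemma sum_point_weight_line:
  assumes M: "M \<in> Ls"
  shows "(\<Sum>x\<in>M. point_weight w x) = sum w Ls + int n * w M"
proof -
  have "(\<Sum>x\<in>M. point_weight w x) = (\<Sum>L\<in>Ls. \<Sum>x\<in>{x \<in> M. x \<in> L}. w L)"
    unfolding point_weight_def pencil_def
    using finite_line[OF M] finite_lines by (rule sum.swap_restrict)
  also have "\<dots> = (\<Sum>L\<in>Ls. w L + (if L = M then int n * w M else 0))"
  proof (rule sum.cong)
    fix L assume L: "L \<in> Ls"
    show "(\<Sum>x\<in>{x \<in> M. x \<in> L}. w L) = w L + (if L = M then int n * w M else 0)"
    proof (cases "L = M")
      case True
      then show ?thesis using card_line[OF M] by (simp add: algebra_simps)
    next
      case False
      then obtain z where "{x \<in> M. x \<in> L} = {z}"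
        using unique_point[OF M L] by blast
      then show ?thesis using False by simp
    qed
  qed simp
  also have "\<dots> = sum w Ls + int n * w M"
    using M finite_lines by (simp add: sum.distrib)
  finally show ?thesis .
qed

lemma magic_function_point_weights:
  assumes "n > 0"
    and inj: "inj_on (\<lambda>x. (point_weight f x mod int n, point_weight g x mod int n,
                           point_weight h x mod int n)) P"
  shows "magic_function (integer_mod_group n \<times>\<times> integer_mod_group n \<times>\<times> integer_mod_group n) P Ls
           (\<lambda>x. (point_weight f x mod int n, point_weight g x mod int n,
                 point_weight h x mod int n))"
  unfolding magic_function_def
proof (intro conjI ballI)
  fix L M assume "L \<in> Ls" "M \<in> Ls"
  then show "(\<Otimes>\<^bsub>integer_mod_group n \<times>\<times> integer_mod_group n \<times>\<times> integer_mod_group n\<^esub>x\<in>L.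
        (point_weight f x mod int n, point_weight g x mod int n, point_weight h x mod int n)) =
      (\<Otimes>\<^bsub>integer_mod_group n \<times>\<times> integer_mod_group n \<times>\<times> integer_mod_group n\<^esub>x\<in>M.
        (point_weight f x mod int n, point_weight g x mod int n, point_weight h x mod int n))"
    using assms(1) finite_line
    by (simp add: finprod_integer_mod_group_cube sum_point_weight_line)
qed (use inj assms(1) in \<open>simp_all add: carrier_integer_mod_group Pi_iff\<close>)

text \<open>Away from the centre \<open>p\<close>, a point lies on just one line that can carry
  weight.\<close>

lemma point_weight_pencil:
  assumes supp: "\<And>L. p \<notin> L \<Longrightarrow> w L = 0"
    and L: "L \<in> Ls" "p \<in> L" "x \<in> L" and "x \<noteq> p"
  shows "point_weight w x = w L"
proof -
  have "point_weight w x = sum w {L}"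
    unfolding point_weight_def
  proof (rule sum.mono_neutral_right)
    show "\<forall>M\<in>pencil x - {L}. w M = 0"
    proof
      fix M assume "M \<in> pencil x - {L}"
      then have "p \<notin> M" using same_line[of M L p x] L \<open>x \<noteq> p\<close> by auto
      then show "w M = 0" by (rule supp)
    qed
  qed (use L in auto)
  then show ?thesis by simp
qed

text \<open>Supplies the first two coordinates. Value 1 marks the points of \<open>l\<close> other
  than \<open>p\<close>; off \<open>l\<close> the value is the weight of the line joining the point
  to \<open>p\<close>, so it determines that line except for the two lines \<open>B\<close> and
  \<open>B'\<close> sharing weight 0.\<close>

lemma ex_pencil_weight:
  assumes n: "n \<ge> 5" and p: "p \<in> P"
    and L: "B \<in> Ls" "B' \<in> Ls" "l \<in> Ls" "p \<in> B" "p \<in> B'" "p \<in> l" "B \<noteq> B'" "B \<noteq> l" "B' \<noteq> l"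
  obtains w where "point_weight w p mod int n \<noteq> 1"
    and "\<And>x. \<lbrakk>x \<in> l; x \<noteq> p\<rbrakk> \<Longrightarrow> point_weight w x mod int n = 1"
    and "\<And>x. \<lbrakk>x \<in> P; x \<notin> l\<rbrakk> \<Longrightarrow> point_weight w x mod int n \<noteq> 1"
    and "\<And>x y. \<lbrakk>x \<in> P; y \<in> P; x \<notin> l; y \<notin> l; point_weight w x mod int n = point_weight w y mod int n\<rbrakk>
        \<Longrightarrow> (\<exists>L\<in>Ls. p \<in> L \<and> x \<in> L \<and> y \<in> L) \<or> x \<in> B \<and> y \<in> B' \<or> x \<in> B' \<and> y \<in> B"
proof -
  define S where "S = pencil p - {B, B', l}"
  have "{B, B', l} \<subseteq> pencil p" using L by auto
  \<comment> \<open>The lines left over are exactly as many as the weights 2 to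
    \<open>n - 1\<close>.\<close>
  then have "card S = n - 2"
    using card_pencil[OF p] L by (simp add: S_def card_Diff_subset)
  then obtain g where g: "bij_betw g S {2..<int n}"
    using finite_same_card_bij[of S "{2..<int n}"] n by (auto simp: S_def nat_diff_distrib)
  define w where "w M = (if M = l then 1 else if M \<in> S then g M else 0)" for M
  have supp: "w M = 0" if "p \<notin> M" for M using that L by (auto simp: w_def S_def)
  have wS: "w M = g M" if "M \<in> S" for M using that by (auto simp: w_def S_def)
  have gS: "g M \<in> {2..<int n}" if "M \<in> S" for M using g that by (rule bij_betwE[rule_format])
  have w_B: "w B = 0" "w B' = 0" "w l = 1" using L by (auto simp: w_def S_def)
  have pen: "pencil p = insert l (insert B (insert B' S))" using L by (auto simp: S_def)
  have "point_weight w p = 1 + sum w S"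
    unfolding point_weight_def pen using L w_B by (simp add: S_def)
  also have "sum w S = \<Sum>{2..<int n}"
    using sum.reindex_bij_betw[OF g, of "\<lambda>i. i"] wS by simp
  \<comment> \<open>All weights of the pencil meet at \<open>p\<close>, and 0, 0, 1, ...,
    \<open>n - 1\<close> add up to half of \<open>n * (n - 1)\<close>.\<close>
  finally have "2 * point_weight w p = int n * (int n - 1)"
    using double_sum_atLeastLessThan_int[of 2 "int n"] n by simp
  from half_multiple_mod_neq[OF this, of 1] n have T: "point_weight w p mod int n \<noteq> 1" by simp
  have range: "0 \<le> w M \<and> w M < int n" for M using gS[of M] n by (auto simp: w_def)
  have val: "point_weight w x mod int n = w M" if "M \<in> Ls" "p \<in> M" "x \<in> M" "x \<noteq> p" for x M
    using point_weight_pencil[of p w, OF supp that] range[of M] by simp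
  have line: "\<exists>M\<in>Ls. p \<in> M \<and> x \<in> M \<and> M \<noteq> l \<and> point_weight w x mod int n = w M"
    if "x \<in> P" "x \<notin> l" for x
  proof -
    have "x \<noteq> p" using that L by auto
    then obtain M where "M \<in> Ls" "p \<in> M" "x \<in> M" using join_exists p \<open>x \<in> P\<close> by metis
    then show ?thesis using val \<open>x \<noteq> p\<close> that by blast
  qed
  show thesis
  proof
    show "point_weight w p mod int n \<noteq> 1" by fact
    show "point_weight w x mod int n = 1" if "x \<in> l" "x \<noteq> p" for x
      using val[OF _ _ that] L w_B by simp
    show "point_weight w x mod int n \<noteq> 1" if x: "x \<in> P" "x \<notin> l" for x
    proof -
      obtain M where M: "M \<noteq> l" "point_weight w x mod int n = w M" using line[OF x] by blast
      have "w M \<noteq> 1" using M(1) gS[of M] by (auto simp: w_def)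
      then show ?thesis using M(2) by simp
    qed
    show "(\<exists>L\<in>Ls. p \<in> L \<and> x \<in> L \<and> y \<in> L) \<or> x \<in> B \<and> y \<in> B' \<or> x \<in> B' \<and> y \<in> B"
      if x: "x \<in> P" and y: "y \<in> P" and xl: "x \<notin> l" and yl: "y \<notin> l"
        and eq: "point_weight w x mod int n = point_weight w y mod int n" for x y
    proof -
      obtain M where M: "M \<in> Ls" "p \<in> M" "x \<in> M" "M \<noteq> l" "point_weight w x mod int n = w M"
        using line[OF x xl] by blast
      obtain N where N: "N \<in> Ls" "p \<in> N" "y \<in> N" "N \<noteq> l" "point_weight w y mod int n = w N"
        using line[OF y yl] by blast
      have MN: "w M = w N" using eq M N by simp
      \<comment> \<open>Weights on \<open>S\<close> are at least 2, so equal weights put both lines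
        into \<open>S\<close>, where \<open>g\<close> is injective, or both outside it.\<close>
      have "M = N \<or> M \<in> {B, B'} \<and> N \<in> {B, B'}"
      proof (cases "M \<in> S \<or> N \<in> S")
        case True
        then have "M \<in> S \<and> N \<in> S"
          using MN gS[of M] gS[of N] M(4) N(4) by (auto simp: w_def split: if_splits)
        then show ?thesis using MN wS g by (auto simp: bij_betw_def inj_on_def)
      qed (use M N in \<open>auto simp: S_def\<close>)
      then show ?thesis using M N by blast
    qed
  qed
qed

text \<open>The five conclusions list what the first two coordinates leave open: the points of
  \<open>l\<close> other than \<open>p\<close> and \<open>q\<close>, a swap of \<open>A\<close> with
  \<open>A'\<close> on a common line through \<open>q\<close>, a swap of \<open>C\<close> with
  \<open>C'\<close> on a common line through \<open>p\<close>, and both swaps at once in two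
  ways.\<close>

lemma ex_diagonal_weight:
  assumes n: "n \<ge> 5"
    and lines: "l \<in> Ls" "A \<in> Ls" "A' \<in> Ls" "C \<in> Ls" "C' \<in> Ls"
    and pq: "p \<in> l" "q \<in> l" "p \<noteq> q"
    and A: "p \<in> A" "p \<in> A'" "A \<noteq> A'" "A \<noteq> l" "A' \<noteq> l"
    and C: "q \<in> C" "q \<in> C'" "C \<noteq> C'" "C \<noteq> l" "C' \<noteq> l"
  obtains w where
    "inj_on (\<lambda>x. point_weight w x mod int n) (l - {p, q})"
    and "\<And>M x x'. \<lbrakk>M \<in> Ls; q \<in> M; M \<noteq> l; x \<in> M; x' \<in> M; x \<in> A; x' \<in> A'\<rbrakk>
        \<Longrightarrow> point_weight w x mod int n \<noteq> point_weight w x' mod int n"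
    and "\<And>M x x'. \<lbrakk>M \<in> Ls; p \<in> M; M \<noteq> l; x \<in> M; x' \<in> M; x \<in> C; x' \<in> C'\<rbrakk>
        \<Longrightarrow> point_weight w x mod int n \<noteq> point_weight w x' mod int n"
    and "\<And>x x'. \<lbrakk>x \<in> A; x \<in> C; x' \<in> A'; x' \<in> C'\<rbrakk>
        \<Longrightarrow> point_weight w x mod int n \<noteq> point_weight w x' mod int n"
    and "\<And>x x'. \<lbrakk>x \<in> A; x \<in> C'; x' \<in> A'; x' \<in> C\<rbrakk>
        \<Longrightarrow> point_weight w x mod int n \<noteq> point_weight w x' mod int n"
proof -
  have sub: "x \<in> P" if "x \<in> L" "L \<in> Ls" for x L using that line_subset by blast
  have A_l: "x = p" if "x \<in> A" "x \<in> l" for x using meet_unique[of A l] lines A pq that by blast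
  have A'_l: "x = p" if "x \<in> A'" "x \<in> l" for x using meet_unique[of A' l] lines A pq that by blast
  have C_l: "x = q" if "x \<in> C" "x \<in> l" for x using meet_unique[of C l] lines C pq that by blast
  have C'_l: "x = q" if "x \<in> C'" "x \<in> l" for x using meet_unique[of C' l] lines C pq that by blast
  have A_A': "x = p" if "x \<in> A" "x \<in> A'" for x using meet_unique[of A A'] lines A that by blast
  have C_C': "x = q" if "x \<in> C" "x \<in> C'" for x using meet_unique[of C C'] lines C that by blast
  have q_A: "q \<notin> A" "q \<notin> A'" using A_l A'_l pq by blast+
  have p_C: "p \<notin> C" "p \<notin> C'" using C_l C'_l pq by blast+
  have AC: "A \<noteq> C" "A' \<noteq> C'" "A \<noteq> C'" "A' \<noteq> C" using p_C A by blast+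
  obtain r where r: "r \<in> P" "r \<in> A" "r \<in> C" using meet_exists[OF lines(2,4) AC(1)] .
  obtain d where d: "d \<in> P" "d \<in> A'" "d \<in> C'" using meet_exists[OF lines(3,5) AC(2)] .
  have r_unique: "x = r" if "x \<in> A" "x \<in> C" for x
    using meet_unique[of A C] lines AC r that by blast
  have d_unique: "x = d" if "x \<in> A'" "x \<in> C'" for x
    using meet_unique[of A' C'] lines AC d that by blast
  have r_out: "r \<notin> l" "r \<notin> A'" "r \<notin> C'" using A_l A_A' C_C' r p_C q_A by blast+
  have d_out: "d \<notin> l" "d \<notin> A" "d \<notin> C" using A'_l A_A' C_C' d p_C q_A by blast+
  have "r \<noteq> d" using r_out d by blast
  then obtain D where D: "D \<in> Ls" "r \<in> D" "d \<in> D" using join_exists r(1) d(1) by metis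
  have "D \<noteq> l" using D r_out by blast
  then obtain e where e: "e \<in> D" "e \<in> l" using meet_exists[of D l] D lines by blast
  \<comment> \<open>Excluding \<open>e\<close> keeps \<open>y\<close> off \<open>D\<close>, so the
    line \<open>K\<close> from \<open>d\<close> to \<open>y\<close> will miss \<open>r\<close> and
    leave the value there unchanged.\<close>
  have "card {p, q, e} < card l"
    using card_line[OF lines(1)] n by (simp add: card_insert_if)
  then have "\<not> l \<subseteq> {p, q, e}" using card_mono[of "{p, q, e}" l] by auto
  then obtain y where y: "y \<in> l" "y \<noteq> p" "y \<noteq> q" "y \<noteq> e" by blast
  have y_D: "y \<notin> D" using meet_unique[of D l e y] D e y \<open>D \<noteq> l\<close> lines by blast
  have y_out: "y \<notin> A" "y \<notin> A'" "y \<notin> C" "y \<notin> C'"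
    using A_l A'_l C_l C'_l y by blast+
  have yP: "y \<in> P" using sub y lines by blast
  obtain K where K: "K \<in> Ls" "d \<in> K" "y \<in> K" using join_exists[OF d(1) yP] y d_out by blast
  have r_K: "r \<notin> K" using same_line[of K D r d] K D \<open>r \<noteq> d\<close> y_D by blast
  \<comment> \<open>Since \<open>K\<close> passes through \<open>d\<close>, its extra weight affects
    no other point of \<open>A'\<close> or \<open>C'\<close>.\<close>
  have K_A': "x = d" if "x \<in> K" "x \<in> A'" for x
    using meet_unique[of K A' x d] K lines y_out d that by blast
  have K_C': "x = d" if "x \<in> K" "x \<in> C'" for x
    using meet_unique[of K C' x d] K lines y_out d that by blast
  have K_l: "x = y" if "x \<in> K" "x \<in> l" for x
    using meet_unique[of K l x y] K lines d_out y that by blast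
  obtain t where t: "t \<in> P" "t \<in> K" "t \<in> A"
    using meet_exists[of K A] K lines y_out by blast
  have t_unique: "x = t" if "x \<in> K" "x \<in> A" for x
    using meet_unique[of K A x t] K lines y_out t that by blast
  have t_out: "t \<notin> l" "t \<noteq> r" "t \<noteq> d" "t \<noteq> q"
    using K_l t y_out r_K d_out q_A by blast+
  \<comment> \<open>The second conclusion compares \<open>t\<close> with one point of
    \<open>A'\<close> only, namely \<open>t'\<close> on the line from \<open>q\<close> to
    \<open>t\<close>.\<close>
  obtain M where M: "M \<in> Ls" "q \<in> M" "t \<in> M"
    using join_exists[of q t] sub pq lines t t_out by metis
  have "M \<noteq> A'" using M q_A by blast
  then obtain t' where t': "t' \<in> P" "t' \<in> M" "t' \<in> A'"
    using meet_exists[of M A'] M lines by blast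
  have t'_unique: "x = t'" if "x \<in> M" "x \<in> A'" for x
    using meet_unique[of M A' x t'] M lines t' that \<open>M \<noteq> A'\<close> by blast
  have "t' \<noteq> r" using t' r_out by blast
  then obtain R where R: "R \<in> Ls" "r \<in> R" "t' \<in> R" using join_exists r(1) t'(1) by metis
  have "t' \<noteq> p" using same_line[of M l p q] M lines pq t' t_out by blast
  then have R_A: "R \<noteq> A" using A_A' R t' by blast
  have "t' \<notin> C"
    using same_line[of M C q t'] M lines C t' q_A t_out r_unique t by blast
  then have R_C: "R \<noteq> C" using R by blast
  have "t' \<noteq> d"
    using same_line[of M C' q t'] M lines C t' q_A t_out d K_C' t by blast
  then have R_D: "R \<noteq> D"
    using meet_unique[of D A' d t'] D lines d t' R r_out by blast
  obtain Y where Y: "Y \<in> Ls" "r \<in> Y" "y \<in> Y" using join_exists[OF r(1) yP] y r_out by blast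
  have Y_ne: "Y \<noteq> A" "Y \<noteq> C" "Y \<noteq> D" using Y y_out y_D by blast+
  have D_ne: "D \<noteq> A" "D \<noteq> C" using D d_out by blast+
  \<comment> \<open>The extra weight of \<open>K\<close> lifts \<open>t\<close> to 3, so \<open>t'\<close> must not receive 3: force it to receive 0.\<close>
  have "\<exists>Z. Z \<in> pencil r - {A, C, D, Y} \<and> R \<in> {Y, Z}"
  proof (cases "R = Y")
    case True
    have "{A, C, D, Y} \<subseteq> pencil r" using r lines D Y by auto
    then have "card (pencil r - {A, C, D, Y}) = n + 1 - 4"
      using card_pencil[OF r(1)] Y_ne D_ne AC by (simp add: card_Diff_subset)
    then have "pencil r - {A, C, D, Y} \<noteq> {}" using n by (intro notI) simp
    then show ?thesis using True by blast
  qed (use R R_A R_C R_D in auto)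
  then obtain Z where Z: "Z \<in> Ls" "r \<in> Z" "Z \<noteq> A" "Z \<noteq> C" "Z \<noteq> D" "Z \<noteq> Y" "R \<in> {Y, Z}"
    by auto

  define S where "S = pencil r - {A, C, D, Y, Z}"
  have "{A, C, D, Y, Z} \<subseteq> pencil r" using r lines D Y Z by auto
  then have "card S = n - 4"
    using card_pencil[OF r(1)] Y_ne D_ne AC Z by (simp add: S_def card_Diff_subset)
  moreover have "card ({3..<int n} - {int n - 2}) = n - 4"
    using n by (simp add: card_Diff_subset nat_diff_distrib)
  ultimately obtain g where g: "bij_betw g S ({3..<int n} - {int n - 2})"
    using finite_same_card_bij[of S "{3..<int n} - {int n - 2}"] by (auto simp: S_def)
  have gS: "g L \<in> {3..<int n} - {int n - 2}" if "L \<in> S" for L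
    using g that by (rule bij_betwE[rule_format])
  \<comment> \<open>With \<open>K\<close> added, \<open>d\<close> receives \<open>n - 1\<close>,
    which differs from 1, 2 and the value at \<open>r\<close>. Weight \<open>n - 1\<close> on
    \<open>D\<close> would give \<open>d\<close> the value 0, which is also the value at
    \<open>r\<close> for odd \<open>n\<close>.\<close>
  define u where "u L = (if L = A then 2 else if L = C then 1 else if L = D then int n - 2
      else if L \<in> S then g L else 0)" for L
  have uS: "u L = g L" if "L \<in> S" for L using that by (auto simp: u_def S_def)
  have u_val: "u A = 2" "u C = 1" "u D = int n - 2" "u Y = 0" "u Z = 0"
    using Y_ne D_ne AC Z by (auto simp: u_def S_def)
  have supp: "u L = 0" if "r \<notin> L" for L using that r D by (auto simp: u_def S_def)
  have u_range: "u L \<in> insert 0 {3..<int n}" if "L \<noteq> A" "L \<noteq> C" for L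
    using that gS[of L] n by (auto simp: u_def)
  \<comment> \<open>Dropping \<open>Y\<close> leaves \<open>Z\<close> as the only line of weight 0
    outside \<open>A\<close> and \<open>C\<close>.\<close>
  have u_inj: "L = L'"
    if "L \<in> pencil r - {A, C, Y}" "L' \<in> pencil r - {A, C, Y}" "u L = u L'" for L L'
  proof -
    have "L \<in> S \<or> L = D \<or> L = Z" "L' \<in> S \<or> L' = D \<or> L' = Z" using that by (auto simp: S_def)
    then show ?thesis
      using that(3) gS[of L] gS[of L'] uS[of L] uS[of L'] u_val n g
      by (auto simp: bij_betw_def inj_on_def)
  qed
  have pen: "pencil r = insert A (insert C (insert D (insert Y (insert Z S))))"
    using r lines D Y Z by (auto simp: S_def)
  have "point_weight u r = int n + 1 + sum u S"
    unfolding point_weight_def pen using Y_ne D_ne AC Z u_val by (simp add: S_def)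
  also have "sum u S = \<Sum>({3..<int n} - {int n - 2})"
    using sum.reindex_bij_betw[OF g, of "\<lambda>i. i"] uS by simp
  also have "\<dots> = \<Sum>{3..<int n} - (int n - 2)"
    using n by (simp add: sum_diff1)
  finally have u_r: "2 * point_weight u r = int n * (int n - 1)"
    using double_sum_atLeastLessThan_int[of 3 "int n"] n by (simp add: algebra_simps)

  define w where "w L = u L + (if L = K then 1 else 0)" for L
  have w_u: "point_weight w x = point_weight u x + (if x \<in> K then 1 else 0)" for x
    using K by (simp add: point_weight_def w_def sum.distrib)
  have w_r: "2 * point_weight w r = int n * (int n - 1)" using w_u u_r r_K by simp
  \<comment> \<open>The value at \<open>r\<close> is 0 or \<open>n / 2\<close> modulo
    \<open>n\<close>. Excluding the residue 2 takes \<open>4 < n\<close>.\<close>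
  define f where "f x = point_weight w x mod int n" for x
  have f_r: "f r \<noteq> 1" "f r \<noteq> 2" "f r \<noteq> int n - 1"
    using half_multiple_mod_neq[OF w_r, of 1] half_multiple_mod_neq[OF w_r, of 2]
      half_multiple_mod_neq[OF w_r, of "-1"] n by (auto simp: f_def zmod_minus1)
  have f_val: "f x = (u L + (if x \<in> K then 1 else 0)) mod int n"
    if "L \<in> Ls" "r \<in> L" "x \<in> L" "x \<noteq> r" for x L
    using w_u point_weight_pencil[of r u, OF supp that] by (simp add: f_def)
  have f_A: "f x = (if x = t then 3 else 2)" if "x \<in> A" "x \<noteq> r" for x
  proof -
    have "x \<in> K \<longleftrightarrow> x = t" using t t_unique that by blast
    then show ?thesis using f_val[OF lines(2) r(2) that] u_val(1) n by simp
  qed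
  have f_C: "f x \<in> {1, 2}" if "x \<in> C" "x \<noteq> r" for x
    using f_val[OF lines(4) r(3) that] u_val(2) n by simp
  have f_C_out: "f x = 1" if "x \<in> C" "x \<noteq> r" "x \<notin> K" for x
    using f_val[OF lines(4) r(3) that(1,2)] that(3) u_val(2) n by simp
  have f_d: "f d = int n - 1"
    using f_val[OF D] K \<open>r \<noteq> d\<close> u_val n by (simp add: zmod_minus1)
  \<comment> \<open>The values 1 and 2 are thus reserved for points of \<open>A\<close>,
    \<open>C\<close> and \<open>K\<close>, apart possibly from \<open>r\<close>, whose value avoids
    both.\<close>
  have f_other: "f x \<in> insert 0 {3..<int n}" if x: "x \<in> P" "x \<notin> A" "x \<notin> C" "x \<notin> K" for x
  proof -
    have "x \<noteq> r" using x r by blast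
    then obtain L where L: "L \<in> Ls" "r \<in> L" "x \<in> L" using join_exists r(1) x(1) by metis
    then have "L \<noteq> A" "L \<noteq> C" using x by auto
    then show ?thesis using f_val[OF L \<open>x \<noteq> r\<close>] u_range[of L] x n by auto
  qed
  have "t' \<notin> K" using K_A' t' \<open>t' \<noteq> d\<close> by blast
  then have f_t': "f t' = 0"
    using f_val[OF R \<open>t' \<noteq> r\<close>] Z u_val by auto
  have f_y: "f y = 1" using f_val[OF Y] y r_out u_val K n by auto

  show thesis
  proof (rule that[of w], unfold f_def[symmetric])
    show "inj_on f (l - {p, q})"
    proof -
      \<comment> \<open>\<open>A\<close>, \<open>C\<close> and \<open>Y\<close> meet
        \<open>l\<close> in \<open>p\<close>, \<open>q\<close> and \<open>y\<close>, and
        \<open>K\<close> meets it in \<open>y\<close>. The remaining points get distinct weights,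
        none equal to 1, while \<open>y\<close> gets 0 + 1.\<close>
      have line: "\<exists>L\<in>pencil r - {A, C, Y}. x \<in> L \<and> f x = u L" if x: "x \<in> l - {p, q}" "x \<noteq> y" for x
      proof -
        have "x \<in> P" "x \<noteq> r" using x sub lines r_out by blast+
        then obtain L where L: "L \<in> Ls" "r \<in> L" "x \<in> L" using join_exists r(1) by metis
        have "L \<noteq> A" "L \<noteq> C" using A_l C_l L x by blast+
        moreover have "L \<noteq> Y" using meet_unique[of Y l x y] Y L x y lines r_out by blast
        moreover have "f x = u L"
          using f_val[OF L \<open>x \<noteq> r\<close>] K_l x u_range[of L] n \<open>L \<noteq> A\<close> \<open>L \<noteq> C\<close> by auto
        ultimately show ?thesis using L by (intro bexI[of _ L]) simp_all
      qed
      have no1: "f x \<noteq> 1" if x: "x \<in> l - {p, q}" "x \<noteq> y" for x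
      proof -
        obtain L where L: "L \<in> pencil r - {A, C, Y}" "f x = u L" using line[OF x] by blast
        then show ?thesis using u_range[of L] by auto
      qed
      show ?thesis
      proof (rule inj_onI)
        fix x x' assume x: "x \<in> l - {p, q}" and x': "x' \<in> l - {p, q}" and eq: "f x = f x'"
        show "x = x'"
        proof (cases "x = y \<or> x' = y")
          case True
          then show ?thesis using no1 x x' eq f_y by metis
        next
          case False
          then obtain L L' where L: "L \<in> pencil r - {A, C, Y}" "x \<in> L" "f x = u L"
            and L': "L' \<in> pencil r - {A, C, Y}" "x' \<in> L'" "f x' = u L'"
            using line x x' by meson
          then have "L = L'" using u_inj eq by metis
          then show ?thesis using meet_unique[of L l x x'] L L' x x' lines r_out by auto
        qed
      qed
    qed
    show "f x \<noteq> f x'"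
      if N: "N \<in> Ls" "q \<in> N" "N \<noteq> l" "x \<in> N" "x' \<in> N" and x: "x \<in> A" "x' \<in> A'" for N x x'
    proof (cases "x = r")
      case True
      then have "N = C" using same_line[of N C q r] N lines C r q_A by blast
      then have "x' \<in> C" "x' \<noteq> r" "x' \<noteq> d" using N r_out x d_out by blast+
      then show ?thesis using f_C_out K_A' x f_r True by metis
    next
      case False
      have "p \<notin> N" using same_line[of N l p q] N lines pq by blast
      then have "x' \<notin> A" using A_A' x N by blast
      have "x' \<notin> C"
        using same_line[of N C q x'] N lines C x q_A r_unique False by blast
      \<comment> \<open>\<open>d\<close> and \<open>t\<close> are the only points of
        \<open>A'\<close> and \<open>A\<close> that \<open>K\<close> changes. Otherwise
        \<open>x\<close> has value 2, and \<open>x'\<close> has value 0 or at least 3.\<close>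
      consider "x' = d" | "x' \<noteq> d" "x = t" | "x' \<noteq> d" "x \<noteq> t" by blast
      then show ?thesis
      proof cases
        case 1
        then have "N = C'" using same_line[of N C' q d] N lines C d q_A by blast
        then have "x \<noteq> t" using K_C' N t t_out by blast
        then show ?thesis using f_A x False f_d 1 n by simp
      next
        case 2
        then have "N = M" using same_line[of N M q t] N M t_out by blast
        then have "x' = t'" using t'_unique N x by blast
        then show ?thesis using f_t' f_A x False 2 by simp
      next
        case 3
        then have "f x' \<in> insert 0 {3..<int n}"
          using f_other[of x'] K_A' x \<open>x' \<notin> A\<close> \<open>x' \<notin> C\<close> sub lines by blast
        then show ?thesis using f_A x False 3 by auto
      qed
    qed
    show "f x \<noteq> f x'"
      if N: "N \<in> Ls" "p \<in> N" "N \<noteq> l" "x \<in> N" "x' \<in> N" and x: "x \<in> C" "x' \<in> C'" for N x x'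
    proof (cases "x = r")
      case True
      then have "N = A" using same_line[of N A p r] N lines A r p_C by blast
      then have "x' \<in> A" "x' \<noteq> r" "x' \<noteq> t" using N r_out x t K_C' t_out by blast+
      then show ?thesis using f_A f_r True by metis
    next
      case False
      have "q \<notin> N" using same_line[of N l p q] N lines pq by blast
      then have "x' \<notin> C" using C_C' x N by blast
      have "x' \<notin> A"
        using same_line[of N A p x'] N lines A x p_C r_unique False by blast
      show ?thesis
      proof (cases "x' = d")
        case True
        then show ?thesis using f_C[OF x(1) False] f_d n by auto
      next
        case x'd: False
        then have "f x' \<in> insert 0 {3..<int n}"
          using f_other[of x'] K_C' x \<open>x' \<notin> A\<close> \<open>x' \<notin> C\<close> sub lines by blast
        then show ?thesis using f_C[OF x(1) False] by auto
      qed
    qed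
    show "f x \<noteq> f x'" if "x \<in> A" "x \<in> C" "x' \<in> A'" "x' \<in> C'" for x x'
      using that r_unique d_unique f_r f_d by metis
    show "f x \<noteq> f x'" if x: "x \<in> A" "x \<in> C'" "x' \<in> A'" "x' \<in> C" for x x'
    proof -
      \<comment> \<open>Neither point lies on \<open>K\<close>, so the plain weights 2 of
        \<open>A\<close> and 1 of \<open>C\<close> are compared.\<close>
      have "x \<noteq> t" "x \<noteq> r" "x' \<noteq> r" "x' \<noteq> d" using K_C' t t_out x r_out d_out by blast+
      moreover have "x' \<notin> K" using K_A' x \<open>x' \<noteq> d\<close> by blast
      ultimately show ?thesis using f_A[OF x(1)] f_C_out[OF x(4)] by simp
    qed
  qed
qed

section \<open>Joint injectivity of the three coordinates\<close>

lemma ex_injective_weights: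
  assumes n: "n \<ge> 5"
  obtains f g h where
    "inj_on (\<lambda>x. (point_weight f x mod int n, point_weight g x mod int n,
                  point_weight h x mod int n)) P"
proof -
  obtain l where l: "l \<in> Ls" using line_avoiding by blast
  then have "card l \<ge> 2" using card_line n by simp
  then obtain p q where pq: "p \<in> l" "q \<in> l" "p \<noteq> q"
    by (meson card_2_iff' obtain_subset_with_card_n subsetD)
  have P: "p \<in> P" "q \<in> P" using pq l line_subset by blast+
  have two: "\<exists>B B'. B \<in> Ls \<and> B' \<in> Ls \<and> x \<in> B \<and> x \<in> B' \<and> B \<noteq> B' \<and> B \<noteq> l \<and> B' \<noteq> l"
    if "x \<in> P" "x \<in> l" for x
  proof -
    have "card (pencil x - {l}) \<ge> 2" using card_pencil[OF that(1)] n l that by simp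
    then obtain T where T: "T \<subseteq> pencil x - {l}" "card T = 2"
      by (meson obtain_subset_with_card_n)
    then obtain B B' where "T = {B, B'}" "B \<noteq> B'" by (metis card_2_iff)
    then show ?thesis using T(1) by (intro exI[of _ B] exI[of _ B']) simp
  qed
  obtain A A' where A: "A \<in> Ls" "A' \<in> Ls" "p \<in> A" "p \<in> A'" "A \<noteq> A'" "A \<noteq> l" "A' \<noteq> l"
    using two P pq by metis
  obtain C C' where C: "C \<in> Ls" "C' \<in> Ls" "q \<in> C" "q \<in> C'" "C \<noteq> C'" "C \<noteq> l" "C' \<noteq> l"
    using two P pq by metis
  show thesis
  proof (rule ex_pencil_weight[OF n P(1) A(1,2) l A(3,4) pq(1) A(5-7)],
      rule ex_pencil_weight[OF n P(2) C(1,2) l C(3,4) pq(2) C(5-7)],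
      rule ex_diagonal_weight[OF n l A(1,2) C(1,2) pq A(3-7) C(3-7)])
    fix f g h
    assume f: "point_weight f p mod int n \<noteq> 1"
        "\<And>x. \<lbrakk>x \<in> l; x \<noteq> p\<rbrakk> \<Longrightarrow> point_weight f x mod int n = 1"
        "\<And>x. \<lbrakk>x \<in> P; x \<notin> l\<rbrakk> \<Longrightarrow> point_weight f x mod int n \<noteq> 1"
        "\<And>x y. \<lbrakk>x \<in> P; y \<in> P; x \<notin> l; y \<notin> l; point_weight f x mod int n = point_weight f y mod int n\<rbrakk>
          \<Longrightarrow> (\<exists>L\<in>Ls. p \<in> L \<and> x \<in> L \<and> y \<in> L) \<or> x \<in> A \<and> y \<in> A' \<or> x \<in> A' \<and> y \<in> A"
      and g: "point_weight g q mod int n \<noteq> 1"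
        "\<And>x. \<lbrakk>x \<in> l; x \<noteq> q\<rbrakk> \<Longrightarrow> point_weight g x mod int n = 1"
        "\<And>x. \<lbrakk>x \<in> P; x \<notin> l\<rbrakk> \<Longrightarrow> point_weight g x mod int n \<noteq> 1"
        "\<And>x y. \<lbrakk>x \<in> P; y \<in> P; x \<notin> l; y \<notin> l; point_weight g x mod int n = point_weight g y mod int n\<rbrakk>
          \<Longrightarrow> (\<exists>L\<in>Ls. q \<in> L \<and> x \<in> L \<and> y \<in> L) \<or> x \<in> C \<and> y \<in> C' \<or> x \<in> C' \<and> y \<in> C"
      and h: "inj_on (\<lambda>x. point_weight h x mod int n) (l - {p, q})"
        "\<And>M x x'. \<lbrakk>M \<in> Ls; q \<in> M; M \<noteq> l; x \<in> M; x' \<in> M; x \<in> A; x' \<in> A'\<rbrakk>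
          \<Longrightarrow> point_weight h x mod int n \<noteq> point_weight h x' mod int n"
        "\<And>M x x'. \<lbrakk>M \<in> Ls; p \<in> M; M \<noteq> l; x \<in> M; x' \<in> M; x \<in> C; x' \<in> C'\<rbrakk>
          \<Longrightarrow> point_weight h x mod int n \<noteq> point_weight h x' mod int n"
        "\<And>x x'. \<lbrakk>x \<in> A; x \<in> C; x' \<in> A'; x' \<in> C'\<rbrakk>
          \<Longrightarrow> point_weight h x mod int n \<noteq> point_weight h x' mod int n"
        "\<And>x x'. \<lbrakk>x \<in> A; x \<in> C'; x' \<in> A'; x' \<in> C\<rbrakk>
          \<Longrightarrow> point_weight h x mod int n \<noteq> point_weight h x' mod int n"
    show thesis
    proof (rule that[of f g h], rule inj_onI)
      fix x y assume x: "x \<in> P" and y: "y \<in> P"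
        and "(point_weight f x mod int n, point_weight g x mod int n, point_weight h x mod int n)
           = (point_weight f y mod int n, point_weight g y mod int n, point_weight h y mod int n)"
      then have eq: "point_weight f x mod int n = point_weight f y mod int n"
        "point_weight g x mod int n = point_weight g y mod int n"
        "point_weight h x mod int n = point_weight h y mod int n" by auto
      \<comment> \<open>Which of the first two coordinates equal 1 decides the class: only the
        second at \<open>p\<close>, only the first at \<open>q\<close>, both on the rest of
        \<open>l\<close>, neither off \<open>l\<close>.\<close>
      have same_type: "x = p \<longleftrightarrow> y = p" "x = q \<longleftrightarrow> y = q" "x \<in> l \<longleftrightarrow> y \<in> l"
        using f(1-3) g(1-3) eq x y pq by metis+
      show "x = y"
      proof (cases "x \<in> l")
        case True
        show ?thesis
        proof (cases "x = p \<or> x = q")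
          case False
          then have "x \<in> l - {p, q}" "y \<in> l - {p, q}" using True same_type by blast+
          then show ?thesis using inj_onD[OF h(1) eq(3)] by blast
        qed (use same_type in blast)
      next
        case False
        have yl: "y \<notin> l" using False same_type by blast
        have px: "(\<exists>L\<in>Ls. p \<in> L \<and> x \<in> L \<and> y \<in> L) \<or> x \<in> A \<and> y \<in> A' \<or> x \<in> A' \<and> y \<in> A"
          using f(4)[OF x y False yl eq(1)] .
        have qx: "(\<exists>L\<in>Ls. q \<in> L \<and> x \<in> L \<and> y \<in> L) \<or> x \<in> C \<and> y \<in> C' \<or> x \<in> C' \<and> y \<in> C"
          using g(4)[OF x y False yl eq(2)] .
        show ?thesis
        \<comment> \<open>On a common line through \<open>p\<close>, the third coordinate excludes a
          swap at \<open>q\<close>, so both points are the meet of two lines. Otherwise there is a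
          swap at \<open>p\<close>, and the third coordinate excludes both a common line through
          \<open>q\<close> and a second swap.\<close>
        proof (cases "\<exists>L\<in>Ls. p \<in> L \<and> x \<in> L \<and> y \<in> L")
          case True
          then obtain L where L: "L \<in> Ls" "p \<in> L" "x \<in> L" "y \<in> L" by blast
          then have "L \<noteq> l" using False by blast
          then have "\<not> (x \<in> C \<and> y \<in> C' \<or> x \<in> C' \<and> y \<in> C)"
            using h(3)[OF L(1,2)] L eq(3) by metis
          then obtain M where M: "M \<in> Ls" "q \<in> M" "x \<in> M" "y \<in> M" using qx by blast
          have "L \<noteq> M" using same_line[of L l p q] L M l pq \<open>L \<noteq> l\<close> by blast
          then show ?thesis using meet_unique L M by blast
        next
          case nL: False
          then have A_cases: "x \<in> A \<and> y \<in> A' \<or> x \<in> A' \<and> y \<in> A" using px by blast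
          have "\<not> (\<exists>M\<in>Ls. q \<in> M \<and> x \<in> M \<and> y \<in> M)"
          proof
            assume "\<exists>M\<in>Ls. q \<in> M \<and> x \<in> M \<and> y \<in> M"
            then obtain M where M: "M \<in> Ls" "q \<in> M" "x \<in> M" "y \<in> M" by blast
            then have "M \<noteq> l" using False by blast
            then show False using h(2)[OF M(1,2)] M A_cases eq(3) by metis
          qed
          then show ?thesis using qx A_cases h(4,5) eq(3) by metis
        qed
      qed
    qed
  qed
qed

end

theorem theorem6:
  fixes P :: "'a set" and Ls :: "'a set set" and n :: nat
  assumes "projective_plane_of_order P Ls n" and "n \<ge> 5"
  shows "magic_over (integer_mod_group n \<times>\<times> integer_mod_group n \<times>\<times> integer_mod_group n) P Ls"
proof -
  interpret projective_plane_of_order P Ls n by fact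
  obtain f g h where "inj_on (\<lambda>x. (point_weight f x mod int n, point_weight g x mod int n,
                  point_weight h x mod int n)) P"
    using ex_injective_weights[OF assms(2)] .
  then show ?thesis
    using magic_function_point_weights[of f g h] assms(2) unfolding magic_over_def by auto
qed

end
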